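(* Let $\mathcal{M}$ be a hereditary class of independence structures having the EF1 property. Let $M=(E,\mathcal{I})$ be any structure from $\mathcal{M}$ with $\chi(M)\leqslant n$, and suppose that there are $n$ agents $1,\ldots,n$ having arbitrary (nonnegative) additive valuations $v_1,\ldots,v_n$ on $E$. Then there exists an epistemic EF1 partition $(X_1,\ldots,X_n)$ of $E$ into $n$ independent sets of $M$; that is, there is a partition $E=X_1\cup\cdots\cup X_n$ with all $X_i\in\mathcal{I}$ such that for every agent $i$ there exists a partition $(Y_1,\ldots,Y_n)$ of $E$ with all $Y_j\in\mathcal{I}$, $Y_i=X_i$, and $v_i(X_i)\geqslant v_i^-(Y_j)$ for every $j\neq i$.
   Context: An independence structure (abstract simplicial complex) is a pair $M=(E,\mathcal{I})$ where $E$ is a finite set (of goods) and $\mathcal{I}$ is a family of subsets of $E$ closed under taking subsets; members of $\mathcal{I}$ are called independent. The chromatic number $\chi(M)$ is the least number of parts in a partition of $E$ into independent sets. A partition into $n$ bundles is an ordered $n$-tuple of pairwise disjoint, possibly empty, sets whose union is the ground set; $n\geqslant 1$ is the number of agents. An additive valuation on $E$ is given by real numbers $v(g)\geqslant 0$ for $g\in E$, with $v(X)=\sum_{g\in X}v(g)$ for $X\subseteq E$. For an additive valuation $v$ and a nonempty $X\subseteq E$, put $v^-(X)=v(X\setminus\{g\})$ where $g\in X$ has maximum value $v(g)$ among the goods in $X$; put $v^-(\emptyset)=0$. For agent $i$ with valuation $v_i$ this is written $v_i^-$. For agents with additive valuations $v_1,\dots,v_q$, a partition $(X_1,\ldots,X_q)$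 is EF1 if $v_i(X_i)\geqslant v_i^-(X_j)$ for all $i,j$. For an integer $q\geqslant\chi(M)$, $M$ is EF1-$q$-colorable if for every nonnegative additive valuation $v$ on $E$ there exists a partition $(X_1,\dots,X_q)$ of $E$ into $q$ independent sets that is EF1 when all $q$ agents have the common valuation $v$, i.e. $v(X_i)\geqslant v^-(X_j)$ for all $i,j$. A class $\mathcal{M}$ of independence structures has the EF1 property if every $M\in\mathcal{M}$ is EF1-$q$-colorable for every integer $q\geqslant\chi(M)$. For $S\subseteq E$, the restriction (induced substructure) of $M=(E,\mathcal{I})$ to $S$ is $M|_S=(S,\mathcal{I}_S)$ with $\mathcal{I}_S=\{X\cap S: X\in\mathcal{I}\}$. A class of independence structures is hereditary if it is closed under induced substructures. *)

theory Defs
  imports Complex_Main "HOL-Library.Extended_Nat" "HOL-Library.Disjoint_Sets"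
begin

type_synonym 'a indep_structure = "'a set \<times> 'a set set"

abbreviation ground :: "'a indep_structure \<Rightarrow> 'a set" where
  "ground \<equiv> fst"

abbreviation indep :: "'a indep_structure \<Rightarrow> 'a set set" where
  "indep \<equiv> snd"

definition independence_structure :: "'a indep_structure \<Rightarrow> bool" where
  "independence_structure M \<longleftrightarrow>
     finite (ground M) \<and> indep M \<subseteq> Pow (ground M) \<and>
     (\<forall>X\<in>indep M. \<forall>Y. Y \<subseteq> X \<longrightarrow> Y \<in> indep M)"

(* The value is \<infinity> if there is no partition into independent sets, which happens
   when some good belongs to no independent set. *)
definition chromatic_number :: "'a indep_structure \<Rightarrow> enat" where
  "chromatic_number M =
     Inf {enat (card P) | P. partition_on (ground M) P \<and> P \<subseteq> indep M}"

definition restrict_structure :: "'a indep_structure \<Rightarrow> 'a set \<Rightarrow> 'a indep_structure" where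
  "restrict_structure M S = (S, {X \<inter> S | X. X \<in> indep M})"

definition hereditary :: "'a indep_structure set \<Rightarrow> bool" where
  "hereditary \<M> \<longleftrightarrow> (\<forall>M\<in>\<M>. \<forall>S. S \<subseteq> ground M \<longrightarrow> restrict_structure M S \<in> \<M>)"

(* An ordered n-tuple of sets is the restriction of a function on nat to {1..n};
   its values outside {1..n} are irrelevant. *)
definition indep_partition :: "'a indep_structure \<Rightarrow> nat \<Rightarrow> (nat \<Rightarrow> 'a set) \<Rightarrow> bool" where
  "indep_partition M n X \<longleftrightarrow>
     (\<Union>i\<in>{1..n}. X i) = ground M \<and> disjoint_family_on X {1..n} \<and>
     (\<forall>i\<in>{1..n}. X i \<in> indep M)"

(* An additive valuation is given by its values on single goods; the value of a
   bundle X is sum v X. *)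
definition valuation_on :: "'a set \<Rightarrow> ('a \<Rightarrow> real) \<Rightarrow> bool" where
  "valuation_on E v \<longleftrightarrow> (\<forall>g\<in>E. v g \<ge> 0)"

definition val_minus :: "('a \<Rightarrow> real) \<Rightarrow> 'a set \<Rightarrow> real" where
  "val_minus v X = (if X = {} then 0 else sum v (X - {arg_max_on v X}))"

definition EF1 :: "(nat \<Rightarrow> 'a \<Rightarrow> real) \<Rightarrow> nat \<Rightarrow> (nat \<Rightarrow> 'a set) \<Rightarrow> bool" where
  "EF1 v q X \<longleftrightarrow> (\<forall>i\<in>{1..q}. \<forall>j\<in>{1..q}. sum (v i) (X i) \<ge> val_minus (v i) (X j))"

definition EF1_colorable :: "nat \<Rightarrow> 'a indep_structure \<Rightarrow> bool" where
  "EF1_colorable q M \<longleftrightarrow>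
     (\<forall>v. valuation_on (ground M) v \<longrightarrow>
        (\<exists>X. indep_partition M q X \<and> EF1 (\<lambda>_. v) q X))"

definition EF1_property :: "'a indep_structure set \<Rightarrow> bool" where
  "EF1_property \<M> \<longleftrightarrow>
     (\<forall>M\<in>\<M>. \<forall>q. enat q \<ge> chromatic_number M \<longrightarrow> EF1_colorable q M)"

definition epistemic_EF1 ::
    "'a indep_structure \<Rightarrow> (nat \<Rightarrow> 'a \<Rightarrow> real) \<Rightarrow> nat \<Rightarrow> (nat \<Rightarrow> 'a set) \<Rightarrow> bool" where
  "epistemic_EF1 M v n X \<longleftrightarrow>
     indep_partition M n X \<and>
     (\<forall>i\<in>{1..n}. \<exists>Y. indep_partition M n Y \<and> Y i = X i \<and>
        (\<forall>j\<in>{1..n}. j \<noteq> i \<longrightarrow> sum (v i) (X i) \<ge> val_minus (v i) (Y j)))"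

end

theory Submission
  imports Defs
begin

text \<open>
  Say that an agent with valuation \<open>w\<close> \<^emph>\<open>accepts\<close> a bundle \<open>S\<close> at level \<open>k\<close> if the remaining goods
  can be divided into at most \<open>k - 1\<close> independent sets none of which is envied by the owner of \<open>S\<close>
  in the EF1 sense.  An epistemic EF1 partition is one in which every agent accepts the own bundle at
  level \<open>n\<close>.  It is constructed by induction on the number \<open>k\<close> of agents.

  Fix one agent \<open>a\<close> and colour the structure by a partition that is EF1 for \<open>k\<close> copies of \<open>a\<close>.  Every
  bundle of it is accepted by \<open>a\<close>, so each bundle is accepted by someone, and there are as many
  bundles as agents.  A Hall-type argument (\<open>envy_free_matching\<close>) then matches some nonempty set of
  these bundles to agents who accept them in such a way that no unmatched agent accepts any of the
  matched bundles.  The matched agents leave with their bundles.  The bundles left over colour the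
  goods left over, so the chromatic number of the induced substructure is at most the number of
  remaining agents.  By heredity the substructure belongs to the class again, so the induction
  hypothesis applies.

  It remains to see that a bundle \<open>Y\<close> accepted by a remaining agent in the substructure is accepted in
  the whole structure (\<open>accepts_extend\<close>).  The natural certificate adds the removed bundles to the
  one for \<open>Y\<close>.  If it fails, some removed bundle is worth more than \<open>Y\<close>; but then the most
  valuable removed bundle is worth at least as much as any other removed bundle and more than
  \<open>Y\<close>, and \<open>Y\<close> in turn is worth enough compared with its own certificate.  So that removed bundle
  would have been acceptable to the agent, which the choice of the matching excludes.
\<close>

section \<open>Matchings in bipartite graphs\<close>

text \<open>
  Hall's marriage theorem, by the argument of Halmos and Vaughan: if some proper subset \<open>T\<close> is tight,
  match \<open>T\<close> and its complement separately; otherwise there is slack everywhere, and an arbitrary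
  edge can be put into the matching.
\<close>

lemma hall:
  assumes "finite A" and "\<And>x. x \<in> A \<Longrightarrow> finite (N x)"
    and "\<And>T. T \<subseteq> A \<Longrightarrow> card T \<le> card (\<Union>(N ` T))"
  shows "\<exists>f. inj_on f A \<and> (\<forall>x\<in>A. f x \<in> N x)"
  using assms
proof (induction "card A" arbitrary: A N rule: less_induct)
  case less
  note fin = less.prems(1) and finN = less.prems(2) and hall = less.prems(3)
  have finU: "finite (\<Union>(N ` T))" if "T \<subseteq> A" for T
    using that fin finN by (meson finite_UN finite_subset subsetD)
  show ?case
  proof (cases "\<exists>T. T \<noteq> {} \<and> T \<subset> A \<and> card (\<Union>(N ` T)) \<le> card T")
    case True
    then obtain T where T: "T \<noteq> {}" "T \<subset> A" "card (\<Union>(N ` T)) \<le> card T" by blast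
    have finT: "finite T" using T(2) fin finite_subset by blast
    have "card T < card A" using T(2) fin by (simp add: psubset_card_mono)
    then have "\<exists>f. inj_on f T \<and> (\<forall>x\<in>T. f x \<in> N x)"
      using T(2) finN hall finT by (intro less.hyps) auto
    then obtain f where f: "inj_on f T" "\<forall>x\<in>T. f x \<in> N x" by blast
    define N' where "N' x = N x - \<Union>(N ` T)" for x
    have "\<exists>g. inj_on g (A - T) \<and> (\<forall>x\<in>A - T. g x \<in> N' x)"
    proof (rule less.hyps)
      show "card (A - T) < card A"
        using T fin by (intro psubset_card_mono) auto
      show "finite (A - T)" using fin by simp
      show "finite (N' x)" if "x \<in> A - T" for x
        using that finN by (simp add: N'_def)
      fix U assume U: "U \<subseteq> A - T"
      have "card U + card T = card (U \<union> T)"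
        using U finT fin by (subst card_Un_disjoint) (auto intro: finite_subset)
      also have "\<dots> \<le> card (\<Union>(N ` (U \<union> T)))"
        using U T(2) by (intro hall) auto
      also have "\<Union>(N ` (U \<union> T)) = \<Union>(N' ` U) \<union> \<Union>(N ` T)"
        by (auto simp: N'_def)
      also have "card \<dots> \<le> card (\<Union>(N' ` U)) + card (\<Union>(N ` T))"
        by (rule card_Un_le)
      finally show "card U \<le> card (\<Union>(N' ` U))"
        using T(3) by linarith
    qed
    then obtain g where g: "inj_on g (A - T)" "\<forall>x\<in>A - T. g x \<in> N' x" by blast
    define h where "h x = (if x \<in> T then f x else g x)" for x
    have "f x \<noteq> g z" if "x \<in> T" "z \<in> A - T" for x z
      using that f(2) g(2) by (auto simp: N'_def)
    then have "inj_on h A"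
      using f(1) g(1) unfolding inj_on_def h_def by (smt (verit) DiffI)
    moreover have "\<forall>x\<in>A. h x \<in> N x"
      using f g by (auto simp: h_def N'_def)
    ultimately show ?thesis by blast
  next
    case slack: False
    show ?thesis
    proof (cases "A = {}")
      case False
      then obtain x where x: "x \<in> A" by blast
      have "card {x} \<le> card (\<Union>(N ` {x}))" using x by (intro hall) auto
      then have "N x \<noteq> {}" by auto
      then obtain y where y: "y \<in> N x" by blast
      define N' where "N' z = N z - {y}" for z
      have "\<exists>g. inj_on g (A - {x}) \<and> (\<forall>z\<in>A - {x}. g z \<in> N' z)"
      proof (rule less.hyps)
        show "card (A - {x}) < card A" using x fin by (intro card_Diff1_less)
        show "finite (A - {x})" using fin by simp
        show "finite (N' z)" if "z \<in> A - {x}" for z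
          using that finN by (simp add: N'_def)
        fix U assume U: "U \<subseteq> A - {x}"
        show "card U \<le> card (\<Union>(N' ` U))"
        proof (cases "U = {}")
          case False
          have "U \<subset> A" using U x by auto
          then have "card U < card (\<Union>(N ` U))"
            using slack False by (meson not_le)
          moreover have "\<Union>(N' ` U) = \<Union>(N ` U) - {y}" by (auto simp: N'_def)
          moreover have "card (\<Union>(N ` U)) \<le> card (\<Union>(N ` U) - {y}) + 1"
            using diff_card_le_card_Diff[of "{y}" "\<Union>(N ` U)"] by simp
          ultimately show ?thesis by simp
        qed simp
      qed
      then obtain g where g: "inj_on g (A - {x})" "\<forall>z\<in>A - {x}. g z \<in> N' z" by blast
      define h where "h z = (if z = x then y else g z)" for z
      have "g z \<noteq> y" if "z \<in> A - {x}" for z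
        using that g(2) by (auto simp: N'_def)
      then have "inj_on h A"
        using g(1) unfolding inj_on_def h_def by (smt (verit) DiffI singletonD)
      moreover have "\<forall>z\<in>A. h z \<in> N z"
        using g y by (auto simp: h_def N'_def)
      ultimately show ?thesis by blast
    qed simp
  qed
qed

text \<open>
  A set \<open>T\<close> of bundles minimal among the nonempty sets with at most \<open>card T\<close> neighbours satisfies
  Hall's condition, and a matching of \<open>T\<close> uses up all of its neighbours; so no agent left unmatched
  is adjacent to \<open>T\<close>.
\<close>

lemma envy_free_matching:
  assumes fin: "finite A" "finite B" and "card A \<le> card B" "B \<noteq> {}"
    and nbr: "\<And>b. b \<in> B \<Longrightarrow> \<exists>a\<in>A. R a b"
  obtains T f where "T \<subseteq> B" "T \<noteq> {}" "inj_on f T" "f ` T \<subseteq> A" "\<And>b. b \<in> T \<Longrightarrow> R (f b) b"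
    and "\<And>a b. \<lbrakk>a \<in> A - f ` T; b \<in> T\<rbrakk> \<Longrightarrow> \<not> R a b"
proof -
  define N where "N b = {a \<in> A. R a b}" for b
  define P where "P T \<longleftrightarrow> T \<subseteq> B \<and> T \<noteq> {} \<and> card (\<Union>(N ` T)) \<le> card T" for T
  have finN: "finite (\<Union>(N ` T))" for T
    by (rule finite_subset[OF _ fin(1)]) (auto simp: N_def)
  have "card (\<Union>(N ` B)) \<le> card A"
    by (intro card_mono fin) (auto simp: N_def)
  then have "P B" using assms by (simp add: P_def)
  then obtain T where T: "P T" and minT: "\<And>U. P U \<Longrightarrow> card T \<le> card U"
    using ex_has_least_nat[of P B card] by blast
  have finT: "finite T" using T fin finite_subset unfolding P_def by blast
  have proper: "card U \<le> card (\<Union>(N ` U)) \<and> (U \<noteq> {} \<longrightarrow> card U < card (\<Union>(N ` U)))"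
    if "U \<subset> T" for U
  proof -
    have "card U < card T" using that finT by (simp add: psubset_card_mono)
    then have "\<not> P U" using minT by (meson not_le)
    then show ?thesis using that T unfolding P_def by (cases "U = {}") auto
  qed
  have "card T \<le> card (\<Union>(N ` T))"
  proof -
    obtain b where b: "b \<in> T" using T P_def by blast
    have sub: "T - {b} \<subset> T" using b by blast
    have mono: "card (\<Union>(N ` (T - {b}))) \<le> card (\<Union>(N ` T))"
      by (intro card_mono finN) auto
    have c: "card T = Suc (card (T - {b}))" using card_Suc_Diff1[OF finT b] by simp
    show ?thesis
    proof (cases "T - {b} = {}")
      case True
      have "\<Union>(N ` T) \<noteq> {}" using nbr b T unfolding N_def P_def by blast
      then have "card (\<Union>(N ` T)) > 0" using finN by (simp add: card_gt_0_iff)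
      then show ?thesis using c unfolding True by simp
    next
      case False
      then show ?thesis using proper[OF sub] mono c by linarith
    qed
  qed
  then have "card U \<le> card (\<Union>(N ` U))" if "U \<subseteq> T" for U
    using that proper by (cases "U = T") auto
  then obtain f where f: "inj_on f T" "\<forall>b\<in>T. f b \<in> N b"
    using hall[OF finT, of N] fin(1) by (auto simp: N_def)
  have "f ` T = \<Union>(N ` T)"
    using f T by (intro card_seteq finN) (auto simp: card_image P_def)
  then show ?thesis
    using f T by (intro that[of T f]) (auto simp: N_def P_def)
qed

section \<open>Acceptable bundles\<close>

lemma val_minus_le_sum:
  assumes "finite X" "\<And>g. g \<in> X \<Longrightarrow> w g \<ge> 0"
  shows "val_minus w X \<le> sum w X"
  using assms unfolding val_minus_def by (auto intro: sum_mono2)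

lemma independence_structureD:
  assumes "independence_structure M" "X \<in> indep M"
  shows "X \<subseteq> ground M" "finite X" "Y \<subseteq> X \<Longrightarrow> Y \<in> indep M"
  using assms unfolding independence_structure_def by (auto intro: finite_subset)

lemma val_minus_le_sum_indep:
  assumes "independence_structure M" "valuation_on (ground M) w" "X \<in> indep M"
  shows "val_minus w X \<le> sum w X"
  using independence_structureD[OF assms(1,3)] assms(2)
  by (intro val_minus_le_sum) (auto simp: valuation_on_def)

text \<open>
  The certificate is an unordered family of disjoint sets, which spares any bookkeeping of positions.
  Having fewer than \<open>k\<close> members loses nothing: empty bundles can be added, and they are never envied.
\<close>

definition accepts :: "'a indep_structure \<Rightarrow> nat \<Rightarrow> ('a \<Rightarrow> real) \<Rightarrow> 'a set \<Rightarrow> bool" where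
  "accepts M k w S \<longleftrightarrow> S \<in> indep M \<and>
     (\<exists>P. finite P \<and> card P < k \<and> P \<subseteq> indep M \<and> disjoint P \<and> \<Union>P = ground M - S \<and>
          (\<forall>Z\<in>P. val_minus w Z \<le> sum w S))"

lemma acceptsI:
  assumes "S \<in> indep M" "finite P" "card P < k" "P \<subseteq> indep M" "disjoint P" "\<Union>P = ground M - S"
    and "\<And>Z. Z \<in> P \<Longrightarrow> val_minus w Z \<le> sum w S"
  shows "accepts M k w S"
  using assms unfolding accepts_def by blast

lemma EF1_imp_accepts:
  assumes "indep_partition M k X" "EF1 (\<lambda>_. w) k X" "b \<in> {1..k}"
  shows "accepts M k w (X b)"
proof (rule acceptsI)
  have dis: "disjoint_family_on X {1..k}" and un: "(\<Union>i\<in>{1..k}. X i) = ground M"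
    using assms(1) unfolding indep_partition_def by auto
  let ?P = "X ` ({1..k} - {b})"
  show "X b \<in> indep M" "?P \<subseteq> indep M"
    using assms unfolding indep_partition_def by auto
  show "card ?P < k"
    using assms(3) by (intro le_less_trans[OF card_image_le]) auto
  show "disjoint ?P"
    using dis by (intro disjoint_family_on_disjoint_image disjoint_family_on_mono[OF _ dis]) auto
  show "\<Union>?P = ground M - X b"
    using dis assms(3) unfolding un[symmetric] disjoint_family_on_def by blast
  show "val_minus w Z \<le> sum w (X b)" if "Z \<in> ?P" for Z
    using that assms(2,3) unfolding EF1_def by auto
qed simp

lemma ground_restrict [simp]: "ground (restrict_structure M F) = F"
  by (simp add: restrict_structure_def)

lemma indep_restrict_subset:
  assumes "independence_structure M"
  shows "indep (restrict_structure M F) \<subseteq> indep M"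
  using independence_structureD(3)[OF assms] by (auto simp: restrict_structure_def)

text \<open>
  The exchange argument.  If \<open>Y\<close> is not acceptable together with the bundles \<open>S b\<close>, some \<open>S b\<close> is
  worth more than \<open>Y\<close> even without its best good.  Then the most valuable \<open>S b\<close> is acceptable: its
  certificate consists of \<open>Y\<close>, the certificate of \<open>Y\<close> and the other \<open>S b\<close>.
\<close>

lemma accepts_extend:
  assumes M: "independence_structure M" and w: "valuation_on (ground M) w"
    and T: "finite T" "disjoint_family_on S T" "\<And>b. b \<in> T \<Longrightarrow> S b \<in> indep M"
    and rejected: "\<And>b. b \<in> T \<Longrightarrow> \<not> accepts M (k + card T) w (S b)"
    and Y: "accepts (restrict_structure M (ground M - (\<Union>b\<in>T. S b))) k w Y"
  shows "accepts M (k + card T) w Y"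
proof (rule ccontr)
  assume neg: "\<not> accepts M (k + card T) w Y"
  define F where "F = ground M - (\<Union>b\<in>T. S b)"
  have MF: "indep (restrict_structure M F) \<subseteq> indep M"
    by (rule indep_restrict_subset[OF M])
  obtain P where P: "finite P" "card P < k" "P \<subseteq> indep M" "disjoint P" "\<Union>P = F - Y"
      "\<And>Z. Z \<in> P \<Longrightarrow> val_minus w Z \<le> sum w Y"
    using Y MF unfolding accepts_def F_def[symmetric] by auto
  have YF: "Y \<subseteq> F" and YM: "Y \<in> indep M"
    using Y MF unfolding accepts_def F_def[symmetric] by (auto simp: restrict_structure_def)
  have SM: "(\<Union>b\<in>T. S b) \<subseteq> ground M"
    using independence_structureD(1)[OF M T(3)] by blast
  have vm: "val_minus w Z \<le> sum w Z" if "Z \<in> indep M" for Z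
    by (rule val_minus_le_sum_indep[OF M w that])
  have disST: "disjoint (S ` U)" if "U \<subseteq> T" for U
    by (intro disjoint_family_on_disjoint_image disjoint_family_on_mono[OF that T(2)])
  obtain l where l: "l \<in> T" "sum w Y < val_minus w (S l)"
  proof (rule ccontr)
    assume "\<not> thesis"
    then have fair: "val_minus w (S b) \<le> sum w Y" if "b \<in> T" for b
      using that \<open>\<And>l. \<lbrakk>l \<in> T; sum w Y < val_minus w (S l)\<rbrakk> \<Longrightarrow> thesis\<close> by force
    have "accepts M (k + card T) w Y"
    proof (rule acceptsI[OF YM, of "P \<union> S ` T"])
      show "card (P \<union> S ` T) < k + card T"
        using card_Un_le[of P "S ` T"] card_image_le[OF T(1), of S] P(2) by linarith
      show "disjoint (P \<union> S ` T)"
        using P(5) by (intro disjoint_union P(4) disST) (auto simp: F_def)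
      show "\<Union>(P \<union> S ` T) = ground M - Y"
        using P(5) YF SM by (auto simp: F_def)
    qed (use P T fair in auto)
    then show False using neg by blast
  qed
  obtain m where m: "m \<in> T" "\<And>b. b \<in> T \<Longrightarrow> sum w (S b) \<le> sum w (S m)"
    using obtains_MAX[of T "\<lambda>b. sum w (S b)"] T(1) l(1)
    by (metis (no_types, lifting) Max_ge empty_iff finite_imageI imageI)
  have Ym: "sum w Y \<le> sum w (S m)"
    using l vm[OF T(3)[OF l(1)]] m(2)[OF l(1)] by linarith
  let ?Q = "insert Y P \<union> S ` (T - {m})"
  have "accepts M (k + card T) w (S m)"
  proof (rule acceptsI[of _ _ ?Q])
    have "card (S ` (T - {m})) < card T"
      using T(1) m(1) by (intro le_less_trans[OF card_image_le] card_Diff1_less) auto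
    moreover have "card (insert Y P) \<le> k"
      using P(1,2) by (intro order_trans[OF card_insert_le_m1]) auto
    ultimately show "card ?Q < k + card T"
      using card_Un_le[of "insert Y P" "S ` (T - {m})"] by linarith
    have "disjoint (insert Y P)"
      using P(4,5) by (auto simp: disjoint_def)
    then show "disjoint ?Q"
      using P(5) YF by (intro disjoint_union disST) (auto simp: F_def)
    have "S b \<inter> S m = {}" if "b \<in> T - {m}" for b
      using that T(2) m(1) unfolding disjoint_family_on_def by auto
    then have "(\<Union>b\<in>T. S b) = S m \<union> (\<Union>b\<in>T - {m}. S b)"
      and "S m \<inter> (\<Union>b\<in>T - {m}. S b) = {}"
      using m(1) by blast+
    then have "F \<union> (\<Union>b\<in>T - {m}. S b) = ground M - S m"
      using SM unfolding F_def by blast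
    moreover have "\<Union>?Q = F \<union> (\<Union>b\<in>T - {m}. S b)"
      using P(5) YF by auto
    ultimately show "\<Union>?Q = ground M - S m" by simp
    show "val_minus w Z \<le> sum w (S m)" if "Z \<in> ?Q" for Z
    proof -
      consider "Z = Y" | "Z \<in> P" | b where "b \<in> T" "Z = S b" using \<open>Z \<in> ?Q\<close> by blast
      then show ?thesis
      proof cases
        case 1
        then show ?thesis using vm[OF YM] Ym by simp
      next
        case 2
        then show ?thesis using P(6) Ym by fastforce
      next
        case 3
        then show ?thesis using vm[OF T(3)] m(2) by fastforce
      qed
    qed
  qed (use P T YM m in auto)
  then show False using rejected m(1) by blast
qed

section \<open>Distributing the goods\<close>

lemma chromatic_number_le_card:
  assumes "finite P" "disjoint P" "\<Union>P = ground M" "P \<subseteq> indep M"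
  shows "chromatic_number M \<le> enat (card P)"
proof -
  have "partition_on (ground M) (P - {{}})"
    using assms by (auto simp: partition_on_def disjoint_def)
  then have "chromatic_number M \<le> enat (card (P - {{}}))"
    unfolding chromatic_number_def using assms(4) by (intro Inf_lower) blast
  also have "\<dots> \<le> enat (card P)"
    using assms(1) by (auto intro: card_mono)
  finally show ?thesis .
qed

lemma chromatic_number_restrict_le:
  assumes X: "indep_partition M k X" and U: "U \<subseteq> {1..k}"
  shows "chromatic_number (restrict_structure M (ground M - (\<Union>b\<in>U. X b))) \<le> enat (k - card U)"
proof -
  let ?V = "{1..k} - U"
  define F where "F = ground M - (\<Union>b\<in>U. X b)"
  have dis: "disjoint_family_on X {1..k}" and un: "(\<Union>i\<in>{1..k}. X i) = ground M"
    and ind: "\<And>i. i \<in> {1..k} \<Longrightarrow> X i \<in> indep M"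
    using X unfolding indep_partition_def by auto
  have sub: "X b \<subseteq> F" if b: "b \<in> ?V" for b
  proof -
    have "X b \<inter> X c = {}" if "c \<in> U" for c
      using disjoint_family_onD[OF dis, of b c] that b U by blast
    moreover have "X b \<subseteq> ground M" using b un by auto
    ultimately show ?thesis unfolding F_def by blast
  qed
  have "chromatic_number (restrict_structure M F) \<le> enat (card (X ` ?V))"
  proof (rule chromatic_number_le_card)
    show "disjoint (X ` ?V)"
      by (intro disjoint_family_on_disjoint_image disjoint_family_on_mono[OF _ dis]) auto
    show "\<Union>(X ` ?V) = ground (restrict_structure M F)"
      using sub un by (fastforce simp: F_def)
    show "X ` ?V \<subseteq> indep (restrict_structure M F)"
    proof
      fix Z assume "Z \<in> X ` ?V"
      then have "Z \<in> indep M" "Z = Z \<inter> F" using ind sub by blast+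
      then show "Z \<in> indep (restrict_structure M F)"
        unfolding restrict_structure_def by auto
    qed
  qed simp
  also have "card (X ` ?V) \<le> k - card U"
    using card_image_le[of ?V X] U by (simp add: card_Diff_subset finite_subset)
  finally show ?thesis by (simp add: F_def)
qed

text \<open>
  The agents form an arbitrary finite set here, since those who remain after a round need not be an
  initial segment.
\<close>

lemma accepted_distribution:
  fixes \<M> :: "'a indep_structure set" and v :: "'i \<Rightarrow> 'a \<Rightarrow> real"
  assumes struct: "\<And>N. N \<in> \<M> \<Longrightarrow> independence_structure N"
    and her: "hereditary \<M>" and EF1: "EF1_property \<M>"
    and "finite I" "M \<in> \<M>" "chromatic_number M \<le> enat (card I)"
    and "\<And>i. i \<in> I \<Longrightarrow> valuation_on (ground M) (v i)"
  shows "\<exists>X. (\<Union>i\<in>I. X i) = ground M \<and> disjoint_family_on X I \<and>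
             (\<forall>i\<in>I. accepts M (card I) (v i) (X i))"
  using assms(4-)
proof (induction "card I" arbitrary: I M rule: less_induct)
  case less
  note finI = less.prems(1) and M = less.prems(2) and chi = less.prems(3) and val = less.prems(4)
  have indM: "independence_structure M" by (rule struct[OF M])
  have col: "EF1_colorable (card I) M" using EF1 M chi unfolding EF1_property_def by blast
  show ?case
  proof (cases "I = {}")
    case True
    \<comment> \<open>A structure that can be coloured with no colours has no goods.\<close>
    have "valuation_on (ground M) (\<lambda>_. 0)" by (simp add: valuation_on_def)
    then have "ground M = {}"
      using col True unfolding EF1_colorable_def indep_partition_def by fastforce
    then show ?thesis using True by (simp add: disjoint_family_on_def)
  next
    case False
    then obtain a where a: "a \<in> I" by blast
    define k where "k = card I"
    have k0: "k > 0" using a finI by (auto simp: k_def card_gt_0_iff)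
    obtain B where B: "indep_partition M k B" "EF1 (\<lambda>_. v a) k B"
      using col val[OF a] unfolding EF1_colorable_def k_def by blast
    have un: "(\<Union>i\<in>{1..k}. B i) = ground M" and dis: "disjoint_family_on B {1..k}"
      and ind: "\<And>i. i \<in> {1..k} \<Longrightarrow> B i \<in> indep M"
      using B(1) unfolding indep_partition_def by auto
    obtain T f where T: "T \<subseteq> {1..k}" "T \<noteq> {}" "inj_on f T" "f ` T \<subseteq> I"
      and acc: "\<And>b. b \<in> T \<Longrightarrow> accepts M k (v (f b)) (B b)"
      and rej: "\<And>i b. \<lbrakk>i \<in> I - f ` T; b \<in> T\<rbrakk> \<Longrightarrow> \<not> accepts M k (v i) (B b)"
      using envy_free_matching[of I "{1..k}" "\<lambda>i b. accepts M k (v i) (B b)"]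
        finI k0 a EF1_imp_accepts[OF B] by (auto simp: k_def) metis
    have finT: "finite T" using T(1) finite_subset by blast
    define J where "J = I - f ` T"
    define F where "F = ground M - (\<Union>b\<in>T. B b)"
    have cT: "card T = card (f ` T)" using T(3) by (simp add: card_image)
    have cTk: "card T \<le> k" using card_mono[OF _ T(1)] by simp
    have cJ: "card J = k - card T"
      using finT T(4) by (simp add: J_def k_def cT card_Diff_subset)
    have "card J < card I"
      using cJ k0 finT T(2) by (simp add: k_def card_gt_0_iff)
    moreover have "restrict_structure M F \<in> \<M>"
      using her M unfolding hereditary_def F_def by blast
    moreover have "chromatic_number (restrict_structure M F) \<le> enat (card J)"
      unfolding cJ F_def by (rule chromatic_number_restrict_le[OF B(1) T(1)])
    moreover have "valuation_on (ground (restrict_structure M F)) (v i)" if "i \<in> J" for i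
      using val that by (auto simp: valuation_on_def J_def F_def)
    moreover have "finite J" using finI by (simp add: J_def)
    ultimately obtain X where X: "(\<Union>i\<in>J. X i) = F" "disjoint_family_on X J"
        "\<And>i. i \<in> J \<Longrightarrow> accepts (restrict_structure M F) (card J) (v i) (X i)"
      using less.hyps[of J "restrict_structure M F"] by auto
    define Z where "Z i = (if i \<in> J then X i else B (inv_into T f i))" for i
    have ZJ: "Z i = X i" if "i \<in> J" for i using that by (simp add: Z_def)
    have Zf: "Z (f b) = B b" if "b \<in> T" for b
      using that T(3) by (simp add: Z_def J_def)
    have I: "I = J \<union> f ` T" using T(4) by (auto simp: J_def)
    show ?thesis
    proof (intro exI[of _ Z] conjI)
      have "(\<Union>i\<in>I. Z i) = F \<union> (\<Union>b\<in>T. B b)"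
        using X(1) ZJ Zf unfolding I by auto
      also have "\<dots> = ground M" using un T(1) by (auto simp: F_def)
      finally show "(\<Union>i\<in>I. Z i) = ground M" .
      have "Z i \<inter> B b = {}" if "i \<in> J" "b \<in> T" for i b
        using that X(1) ZJ by (auto simp: F_def)
      moreover have "B b \<inter> B c = {}" if "b \<in> T" "c \<in> T" "b \<noteq> c" for b c
        using dis T(1) that unfolding disjoint_family_on_def by blast
      moreover have "Z i \<inter> Z j = {}" if "i \<in> J" "j \<in> J" "i \<noteq> j" for i j
        using X(2) that ZJ unfolding disjoint_family_on_def by auto
      ultimately show "disjoint_family_on Z I"
        unfolding I disjoint_family_on_def by (smt (verit) Un_iff Zf imageE Int_commute)
      show "\<forall>i\<in>I. accepts M (card I) (v i) (Z i)"
      proof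
        fix i assume i: "i \<in> I"
        show "accepts M (card I) (v i) (Z i)"
        proof (cases "i \<in> J")
          case True
          have kk: "card J + card T = card I" using cJ cTk by (simp add: k_def)
          have "accepts M (card J + card T) (v i) (X i)"
          proof (rule accepts_extend[OF indM val[OF i] finT])
            show "disjoint_family_on B T" by (rule disjoint_family_on_mono[OF T(1) dis])
            show "accepts (restrict_structure M (ground M - (\<Union>b\<in>T. B b))) (card J) (v i) (X i)"
              using X(3)[OF True] by (simp add: F_def)
            show "B b \<in> indep M" if "b \<in> T" for b
              using ind T(1) that by blast
            show "\<not> accepts M (card J + card T) (v i) (B b)" if "b \<in> T" for b
              using rej[OF _ that] True unfolding kk by (simp add: J_def k_def)
          qed
          then show ?thesis using ZJ[OF True] kk by simp
        next
          case False
          then obtain b where "b \<in> T" "i = f b" using i I by blast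
          then show ?thesis using acc Zf by (simp add: k_def)
        qed
      qed
    qed
  qed
qed

text \<open>
  Numbering the certificate by the other agents and padding it with empty bundles gives the
  partition that agent \<open>i\<close> has to exhibit.
\<close>

lemma accepts_imp_partition:
  assumes M: "independence_structure M" and w: "valuation_on (ground M) w"
    and S: "accepts M n w S" and i: "i \<in> {1..n}"
  shows "\<exists>Y. indep_partition M n Y \<and> Y i = S \<and>
             (\<forall>j\<in>{1..n}. j \<noteq> i \<longrightarrow> sum w S \<ge> val_minus w (Y j))"
proof -
  obtain P where P: "finite P" "card P < n" "P \<subseteq> indep M" "disjoint P" "\<Union>P = ground M - S"
      "\<And>Z. Z \<in> P \<Longrightarrow> val_minus w Z \<le> sum w S"
    using S unfolding accepts_def by blast
  have SM: "S \<in> indep M" using S unfolding accepts_def by blast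
  have Sg: "S \<subseteq> ground M" and empty: "{} \<in> indep M"
    using independence_structureD[OF M SM] by auto
  have S0: "0 \<le> sum w S"
    using Sg w by (intro sum_nonneg) (auto simp: valuation_on_def)
  have "card P \<le> card ({1..n} - {i})" using P(2) i by simp
  then obtain g where g: "inj_on g P" "g ` P \<subseteq> {1..n} - {i}"
    using card_le_inj[OF P(1), of "{1..n} - {i}"] by auto
  define Y where "Y j = (if j = i then S else if j \<in> g ` P then inv_into P g j else {})" for j
  have Yi: "Y i = S" by (simp add: Y_def)
  have Yg: "Y (g Z) = Z" if "Z \<in> P" for Z
    using that g by (auto simp: Y_def)
  have Y0: "Y j = {}" if "j \<noteq> i" "j \<notin> g ` P" for j using that by (simp add: Y_def)
  have cover: thesis
    if "j = i \<Longrightarrow> thesis" "\<And>Z. \<lbrakk>Z \<in> P; j = g Z\<rbrakk> \<Longrightarrow> thesis" "Y j = {} \<Longrightarrow> thesis" for j thesis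
    using that Y0[of j] by blast
  have gi: "g Z \<noteq> i" "g Z \<in> {1..n}" if "Z \<in> P" for Z
    using g(2) that by auto
  have un: "(\<Union>j\<in>{1..n}. Y j) = ground M"
  proof
    have "Y j \<subseteq> ground M" for j
      by (rule cover[of j]) (use P(5) Sg Yi Yg in auto)
    then show "(\<Union>j\<in>{1..n}. Y j) \<subseteq> ground M" by blast
    have "Z \<subseteq> (\<Union>j\<in>{1..n}. Y j)" if "Z \<in> P" for Z
      using UN_upper[OF gi(2)[OF that], of Y] by (simp add: Yg[OF that])
    moreover have "S \<subseteq> (\<Union>j\<in>{1..n}. Y j)"
      using UN_upper[OF i, of Y] by (simp add: Yi)
    ultimately have "S \<union> \<Union>P \<subseteq> (\<Union>j\<in>{1..n}. Y j)"
      by (intro Un_least Sup_least)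
    then show "ground M \<subseteq> (\<Union>j\<in>{1..n}. Y j)"
      using P(5) Sg by simp
  qed
  have SP: "S \<inter> Z = {}" if "Z \<in> P" for Z using that P(5) by blast
  have PP: "Z \<inter> Z' = {}" if "Z \<in> P" "Z' \<in> P" "Z \<noteq> Z'" for Z Z'
    using that P(4) by (auto simp: disjoint_def)
  have SY: "S \<inter> Y l = {}" if "l \<noteq> i" for l
    by (rule cover[of l]) (use that in \<open>simp_all add: Yg SP\<close>)
  have PY: "Z \<inter> Y l = {}" if "Z \<in> P" "l \<noteq> g Z" for Z l
  proof (rule cover[of l])
    show "Z \<inter> Y l = {}" if "l = i"
      using that SP[OF \<open>Z \<in> P\<close>] Yi by (simp add: Int_commute)
    show "Z \<inter> Y l = {}" if "Z' \<in> P" "l = g Z'" for Z'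
      using PP[OF \<open>Z \<in> P\<close> \<open>Z' \<in> P\<close>] that \<open>l \<noteq> g Z\<close> Yg by auto
  qed simp
  have "Y j \<inter> Y l = {}" if "j \<noteq> l" for j l
    by (rule cover[of j]) (use that SY PY in \<open>auto simp: Yi Yg\<close>)
  then have dis: "disjoint_family_on Y {1..n}"
    unfolding disjoint_family_on_def by blast
  have ind: "Y j \<in> indep M" for j
    by (rule cover[of j]) (use SM empty P(3) in \<open>auto simp: Yi Yg\<close>)
  have fair: "val_minus w (Y j) \<le> sum w S" if "j \<noteq> i" for j
    by (rule cover[of j]) (use that S0 P(6) in \<open>auto simp: Yg val_minus_def[of w "{}"]\<close>)
  show ?thesis
    using un dis Yi ind fair unfolding indep_partition_def by blast
qed

theorem theorem1:
  fixes \<M> :: "'a indep_structure set"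
    and M :: "'a indep_structure"
    and n :: nat
    and v :: "nat \<Rightarrow> 'a \<Rightarrow> real"
  assumes "\<And>N. N \<in> \<M> \<Longrightarrow> independence_structure N"
    and "hereditary \<M>"
    and "EF1_property \<M>"
    and "M \<in> \<M>"
    and "n \<ge> 1"
    and "chromatic_number M \<le> enat n"
    and "\<And>i. i \<in> {1..n} \<Longrightarrow> valuation_on (ground M) (v i)"
  shows "\<exists>X. epistemic_EF1 M v n X"
proof -
  obtain X where X: "(\<Union>i\<in>{1..n}. X i) = ground M" "disjoint_family_on X {1..n}"
      "\<And>i. i \<in> {1..n} \<Longrightarrow> accepts M n (v i) (X i)"
    using accepted_distribution[OF assms(1,2,3) _ assms(4), of "{1..n}" v] assms(6,7) by auto
  then have "indep_partition M n X"
    unfolding indep_partition_def accepts_def by auto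
  moreover have "\<exists>Y. indep_partition M n Y \<and> Y i = X i \<and>
      (\<forall>j\<in>{1..n}. j \<noteq> i \<longrightarrow> sum (v i) (X i) \<ge> val_minus (v i) (Y j))" if "i \<in> {1..n}" for i
    using accepts_imp_partition[OF assms(1)[OF assms(4)] assms(7) X(3)] that by blast
  ultimately show ?thesis
    unfolding epistemic_EF1_def by blast
qed

end
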